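(* Let $\bar a=(a_1,a_2,a_3,a_4)$, $\bar p=(p_1,p_2,p_3,p_4)$, $\bar x=(x_1,x_2,x_3,x_4)$, $\bar q=(q_1,q_2,q_3,q_4)$ be complex vectors with $a_ix_ip_iq_i\neq 0$ for $1\le i\le 4$, and put $K:=a_1a_2a_3a_4$, $L:=\sqrt{p_1p_2p_3p_4}$, $K_0:=x_1x_2x_3x_4$, $L_0:=\sqrt{q_1q_2q_3q_4}$. Let $n\ge 0$ be an integer and assume that no denominator below vanishes. Then $$\sum_{k=0}^{n-1}(-1)^k\frac{\Gamma_{k-1}[\bar a;\bar p]}{(K_0;L_0)_k}\,\frac{KL^{k-1}-1}{KL^{k-1}}\prod_{i=1}^4\frac{(a_i^2;p_i)_{k-1}(x_i^2;q_i)_k}{(K/a_i^2;L/p_i)_k}\prod_{j=0}^{k-1}\frac{K_0L_0^j}{\Gamma_j[\bar x;\bar q]}$$ $$=\frac{(-1)^n}{(K_0;L_0)_n}\prod_{i=1}^4\frac{(a_i^2;p_i)_{n-1}(x_i^2;q_i)_n}{(K/a_i^2;L/p_i)_{n-1}}\prod_{j=0}^{n-1}\frac{K_0L_0^j}{\Gamma_j[\bar x;\bar q]}-\prod_{i=1}^4\frac{L/p_i-K/a_i^2}{p_i-a_i^2}$$ $$+\sum_{k=0}^{n-1}\frac{(-1)^k}{(K_0;L_0)_{k+1}}\prod_{j=0}^{k}\frac{K_0L_0^j}{\Gamma_j[\bar x;\bar q]}\prod_{i=1}^4\frac{(a_i^2;p_i)_k(x_i^2;q_i)_k\bigl(1-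K_0L_0^k/(x_i^2q_i^k)\bigr)}{(K/a_i^2;L/p_i)_k}.$$
   Context: For a nonzero base $q$ and an integer $m\ge 0$, $(a;q)_m=\prod_{j=0}^{m-1}(1-aq^j)$ and $(a;q)_{-m}=1/\prod_{j=1}^{m}(1-aq^{-j})$; in particular $(a;q)_{-1}=1/(1-a/q)$. For any integer $k$, $$\Gamma_k[\bar x;\bar q]:=\bigl(x_1x_2(q_1q_2)^{k/2}-x_3x_4(q_3q_4)^{k/2}\bigr)\bigl(x_1x_3(q_1q_3)^{k/2}-x_2x_4(q_2q_4)^{k/2}\bigr)\bigl(x_1x_4(q_1q_4)^{k/2}-x_2x_3(q_2q_3)^{k/2}\bigr),$$ and $\Gamma_k[\bar a;\bar p]$ is the same expression with $(x_i,q_i)$ replaced by $(a_i,p_i)$. Square roots are taken consistently: fix a square root $q_i^{1/2}$ of each $q_i$ and $p_i^{1/2}$ of each $p_i$; then $(q_iq_j)^{k/2}=(q_i^{1/2}q_j^{1/2})^k$, $L_0=\prod_i q_i^{1/2}$, and similarly $(p_ip_j)^{k/2}=(p_i^{1/2}p_j^{1/2})^k$, $L=\prod_i p_i^{1/2}$. Empty sums are $0$ and empty products are $1$. *)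

theory Defs
  imports "HOL-Analysis.Analysis"
begin

text \<open>
  The \<open>q\<close>-shifted factorial \<open>(a;q)\<^sub>m\<close> for an integer index \<open>m\<close> and a base \<open>q \<noteq> 0\<close>.
  For \<open>m < 0\<close> it is a reciprocal; since \<open>1 / 0 = 0\<close>, it is then zero exactly
  when \<open>(a;q)\<^sub>m\<close> is undefined.
\<close>

definition qpoch :: "complex \<Rightarrow> complex \<Rightarrow> int \<Rightarrow> complex" where
  "qpoch a q m =
     (if m \<ge> 0 then (\<Prod>j<nat m. 1 - a * q ^ j)
      else 1 / (\<Prod>j=1..nat (- m). 1 - a * q powi (- int j)))"

text \<open>
  \<open>Gam k x s\<close> is \<open>\<Gamma>\<^sub>k[x;q]\<close>, where \<open>s\<close> is the vector of the chosen square roots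
  \<open>s\<^sub>i = q\<^sub>i\<^bsup>1/2\<^esup>\<close>, so that \<open>(q\<^sub>i q\<^sub>j)\<^bsup>k/2\<^esup> = (s\<^sub>i s\<^sub>j)\<^bsup>k\<^esup>\<close>.
\<close>

definition Gam :: "int \<Rightarrow> complex ^ 4 \<Rightarrow> complex ^ 4 \<Rightarrow> complex" where
  "Gam k x s =
     (x$1 * x$2 * (s$1 * s$2) powi k - x$3 * x$4 * (s$3 * s$4) powi k) *
     (x$1 * x$3 * (s$1 * s$3) powi k - x$2 * x$4 * (s$2 * s$4) powi k) *
     (x$1 * x$4 * (s$1 * s$4) powi k - x$2 * x$3 * (s$2 * s$3) powi k)"

end

theory Submission
  imports Defs
begin

text \<open>
  The theorem is summation by parts for the sequences
  \[ U_k = \prod_i \frac{(a_i^2;p_i)_k}{(K/a_i^2;L/p_i)_k}, \qquad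
     V_k = \frac{(-1)^k}{(K_0;L_0)_k} \prod_i (x_i^2;q_i)_k \prod_{j<k} \frac{K_0L_0^j}{\Gamma_j[x;q]}. \]
  With \<open>B = b\<^sub>1b\<^sub>2b\<^sub>3b\<^sub>4\<close>, both differences \<open>U\<^sub>k - U\<^sub>k\<^sub>-\<^sub>1\<close> and \<open>V\<^sub>k\<^sub>+\<^sub>1 - V\<^sub>k\<close> are evaluated by one rational identity:
  \[ \prod_i (1 - b_i^2) - \prod_i (1 - B/b_i^2)
     = \frac{B-1}{B} (b_1b_2 - b_3b_4)(b_1b_3 - b_2b_4)(b_1b_4 - b_2b_3). \]
\<close>

text \<open>Each factor \<open>1 - B / bi\<^sup>2\<close> has numerator \<open>bi\<close> minus the
  product of the other three variables. The four denominators \<open>bi\<close> multiply to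
  \<open>B\<close>, so clearing them leaves a polynomial identity.\<close>

lemma four_variable_identity:
  fixes b1 b2 b3 b4 :: complex
  defines "B \<equiv> b1 * b2 * b3 * b4"
  assumes "B \<noteq> 0"
  shows "(1 - b1\<^sup>2) * (1 - b2\<^sup>2) * (1 - b3\<^sup>2) * (1 - b4\<^sup>2)
       - (1 - B / b1\<^sup>2) * (1 - B / b2\<^sup>2) * (1 - B / b3\<^sup>2) * (1 - B / b4\<^sup>2)
       = (B - 1) / B * ((b1 * b2 - b3 * b4) * (b1 * b3 - b2 * b4) * (b1 * b4 - b2 * b3))"
proof -
  have nz: "b1 \<noteq> 0" "b2 \<noteq> 0" "b3 \<noteq> 0" "b4 \<noteq> 0"
    using assms by auto
  have e: "1 - B / b1\<^sup>2 = (b1 - b2 * b3 * b4) / b1" "1 - B / b2\<^sup>2 = (b2 - b1 * b3 * b4) / b2"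
    "1 - B / b3\<^sup>2 = (b3 - b1 * b2 * b4) / b3" "1 - B / b4\<^sup>2 = (b4 - b1 * b2 * b3) / b4"
    using nz by (simp_all add: B_def divide_simps power2_eq_square)
  define P where "P = (1 - b1\<^sup>2) * (1 - b2\<^sup>2) * (1 - b3\<^sup>2) * (1 - b4\<^sup>2)"
  define N where "N = (b1 - b2 * b3 * b4) * (b2 - b1 * b3 * b4) * (b3 - b1 * b2 * b4) * (b4 - b1 * b2 * b3)"
  define G where "G = (b1 * b2 - b3 * b4) * (b1 * b3 - b2 * b4) * (b1 * b4 - b2 * b3)"
  have "(1 - B / b1\<^sup>2) * (1 - B / b2\<^sup>2) * (1 - B / b3\<^sup>2) * (1 - B / b4\<^sup>2) = N / B"
    unfolding e times_divide_times_eq by (simp only: B_def N_def)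
  moreover have "P * B - N = (B - 1) * G"
    by (simp add: B_def P_def N_def G_def algebra_simps power2_eq_square)
  then have "P - N / B = (B - 1) / B * G"
    using \<open>B \<noteq> 0\<close> by (simp add: field_simps)
  ultimately show ?thesis
    by (simp only: P_def G_def)
qed

lemma prod_UNIV_4: "prod f (UNIV :: 4 set) = f 1 * f 2 * f 3 * f 4"
  for f :: "4 \<Rightarrow> 'a :: comm_monoid_mult"
  unfolding UNIV_4 by (simp add: ac_simps)

text \<open>Substituting \<open>x$i * s$i powi m\<close> for the four variables turns
  \<open>B\<close> into \<open>X * S powi m\<close> and the triple product into
  \<open>Gam m x s\<close>. The exponent is an integer because the differences of \<open>U\<close>
  start at \<open>m = -1\<close>.\<close>

lemma Gam_identity:
  fixes x s :: "complex ^ 4" and m :: int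
  assumes x: "\<And>i. x$i \<noteq> 0" and s: "\<And>i. s$i \<noteq> 0"
    and X: "X = x$1 * x$2 * x$3 * x$4" and S: "S = s$1 * s$2 * s$3 * s$4"
  shows "(\<Prod>i\<in>UNIV. 1 - (x$i)\<^sup>2 * ((s$i)\<^sup>2) powi m)
       - (\<Prod>i\<in>UNIV. 1 - X * S powi m / ((x$i)\<^sup>2 * ((s$i)\<^sup>2) powi m))
       = (X * S powi m - 1) / (X * S powi m) * Gam m x s"
proof -
  define b where "b i = x$i * s$i powi m" for i
  have sq: "(x$i)\<^sup>2 * ((s$i)\<^sup>2) powi m = (b i)\<^sup>2" for i
    by (simp add: b_def power_mult_distrib power2_eq_square power_int_mult_distrib)
  have B: "X * S powi m = b 1 * b 2 * b 3 * b 4"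
    by (simp add: X S b_def power_int_mult_distrib)
  have nz: "b 1 * b 2 * b 3 * b 4 \<noteq> 0"
    using x s by (simp add: b_def)
  have G: "Gam m x s = (b 1 * b 2 - b 3 * b 4) * (b 1 * b 3 - b 2 * b 4) * (b 1 * b 4 - b 2 * b 3)"
    by (simp add: Gam_def b_def power_int_mult_distrib mult_ac)
  show ?thesis
    unfolding sq B G prod_UNIV_4 by (rule four_variable_identity[OF nz])
qed

lemma qpoch_0 [simp]: "qpoch a q 0 = 1"
  by (simp add: qpoch_def)

lemma qpoch_minus_one: "qpoch a q (-1) = 1 / (1 - a / q)"
  by (simp add: qpoch_def field_simps)

lemma qpoch_Suc: "qpoch a q (int (Suc k)) = qpoch a q (int k) * (1 - a * q ^ k)"
  by (simp add: qpoch_def nat_add_distrib)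

text \<open>Pairing the increment of \<open>U\<close> with the old \<open>V\<close> and that of
  \<open>V\<close> with the new \<open>U\<close> splits
  \<open>U (Suc k) * V (Suc k) - U k * V k\<close> exactly, and this telescopes.\<close>

lemma summation_by_parts:
  fixes U V :: "nat \<Rightarrow> 'a :: comm_ring"
  shows "(\<Sum>k<n. (U (Suc k) - U k) * V k)
       = U n * V n - U 0 * V 0 - (\<Sum>k<n. U (Suc k) * (V (Suc k) - V k))"
  by (induction n) (simp_all add: algebra_simps)

theorem theorem2p2:
  fixes a p x q :: "complex ^ 4"
    and sp sq :: "complex ^ 4"
    and K L K0 L0 :: complex
    and n :: nat
  assumes nonzero: "\<forall>i. a$i * x$i * p$i * q$i \<noteq> 0"
    and sqrt_p: "\<forall>i. (sp$i)\<^sup>2 = p$i"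
    and sqrt_q: "\<forall>i. (sq$i)\<^sup>2 = q$i"
    and K: "K = a$1 * a$2 * a$3 * a$4"
    and L: "L = sp$1 * sp$2 * sp$3 * sp$4"
    and K0: "K0 = x$1 * x$2 * x$3 * x$4"
    and L0: "L0 = sq$1 * sq$2 * sq$3 * sq$4"
    and denom_K0: "\<forall>k\<le>n. qpoch K0 L0 (int k) \<noteq> 0"
    and denom_K: "\<forall>i. \<forall>k<n. qpoch (K / (a$i)\<^sup>2) (L / p$i) (int k) \<noteq> 0"
    and denom_K_last: "\<forall>i. qpoch (K / (a$i)\<^sup>2) (L / p$i) (int n - 1) \<noteq> 0"
    and denom_Gam: "\<forall>j<n. Gam (int j) x sq \<noteq> 0"
    and denom_p: "\<forall>i. p$i - (a$i)\<^sup>2 \<noteq> 0"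
  shows
    "(\<Sum>k<n. (-1) ^ k
        * (Gam (int k - 1) a sp / qpoch K0 L0 (int k))
        * ((K * L powi (int k - 1) - 1) / (K * L powi (int k - 1)))
        * (\<Prod>i\<in>UNIV. qpoch ((a$i)\<^sup>2) (p$i) (int k - 1) * qpoch ((x$i)\<^sup>2) (q$i) (int k)
                    / qpoch (K / (a$i)\<^sup>2) (L / p$i) (int k))
        * (\<Prod>j<k. K0 * L0 ^ j / Gam (int j) x sq))
     = (-1) ^ n / qpoch K0 L0 (int n)
        * (\<Prod>i\<in>UNIV. qpoch ((a$i)\<^sup>2) (p$i) (int n - 1) * qpoch ((x$i)\<^sup>2) (q$i) (int n)
                    / qpoch (K / (a$i)\<^sup>2) (L / p$i) (int n - 1))
        * (\<Prod>j<n. K0 * L0 ^ j / Gam (int j) x sq)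
       - (\<Prod>i\<in>UNIV. (L / p$i - K / (a$i)\<^sup>2) / (p$i - (a$i)\<^sup>2))
       + (\<Sum>k<n. (-1) ^ k / qpoch K0 L0 (int k + 1)
            * (\<Prod>j\<le>k. K0 * L0 ^ j / Gam (int j) x sq)
            * (\<Prod>i\<in>UNIV. qpoch ((a$i)\<^sup>2) (p$i) (int k) * qpoch ((x$i)\<^sup>2) (q$i) (int k)
                          * (1 - K0 * L0 ^ k / ((x$i)\<^sup>2 * (q$i) ^ k))
                        / qpoch (K / (a$i)\<^sup>2) (L / p$i) (int k)))"
proof -
  have nza: "a$i \<noteq> 0" and nzx: "x$i \<noteq> 0" and nzp: "p$i \<noteq> 0" and nzq: "q$i \<noteq> 0" for i
    using nonzero by auto
  have nzsp: "sp$i \<noteq> 0" and nzsq: "sq$i \<noteq> 0" for i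
    using nzp[of i] nzq[of i] sqrt_p sqrt_q by (metis zero_power2)+
  have nzK: "K \<noteq> 0" "L \<noteq> 0" "K0 \<noteq> 0" "L0 \<noteq> 0"
    using nza nzx nzsp nzsq by (simp_all add: K L K0 L0)
  have p_a: "p$i \<noteq> (a$i)\<^sup>2" for i
    using denom_p by auto

  \<comment> \<open>\<open>U k\<close> is the \<open>U\<^sub>k\<^sub>-\<^sub>1\<close> of the header; its value at \<open>k = 0\<close> is written without \<open>(K/a\<^sub>i\<^sup>2;L/p\<^sub>i)\<^sub>-\<^sub>1\<close>,
    which need not exist when \<open>n > 0\<close>.\<close>
  define U where "U k = (case k of 0 \<Rightarrow> (\<Prod>i\<in>UNIV. (L / p$i - K / (a$i)\<^sup>2) / (p$i - (a$i)\<^sup>2))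
      | Suc m \<Rightarrow> (\<Prod>i\<in>UNIV. qpoch ((a$i)\<^sup>2) (p$i) (int m) / qpoch (K / (a$i)\<^sup>2) (L / p$i) (int m)))" for k
  define g where "g k = (\<Prod>j<k. K0 * L0 ^ j / Gam (int j) x sq)" for k
  define Q where "Q k = (\<Prod>i\<in>UNIV. qpoch ((x$i)\<^sup>2) (q$i) (int k))" for k
  define V where "V k = (-1) ^ k / qpoch K0 L0 (int k) * Q k * g k" for k

  \<comment> \<open>The two forms of \<open>U 0\<close> differ in the factor at \<open>i\<close> by
    \<open>p$i ^ 2 / L\<close>. They agree only as full products, because \<open>L ^ 2\<close> is
    the product of the \<open>p$i\<close>.\<close>
  have prod_p: "(\<Prod>i\<in>UNIV. p$i ^ 2 / L) = 1"
    using nzsp by (simp add: prod_UNIV_4 L sqrt_p[rule_format, symmetric] divide_simps power2_eq_square)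
  have U0: "U 0 = (\<Prod>i\<in>UNIV. (1 - K * p$i / (L * (a$i)\<^sup>2)) / (1 - (a$i)\<^sup>2 / p$i))"
  proof -
    have "U 0 = (\<Prod>i\<in>UNIV. p$i ^ 2 / L) * (\<Prod>i\<in>UNIV. (L / p$i - K / (a$i)\<^sup>2) / (p$i - (a$i)\<^sup>2))"
      unfolding prod_p by (simp add: U_def)
    also have "\<dots> = (\<Prod>i\<in>UNIV. p$i ^ 2 / L * ((L / p$i - K / (a$i)\<^sup>2) / (p$i - (a$i)\<^sup>2)))"
      by (rule prod.distrib[symmetric])
    also have "\<dots> = (\<Prod>i\<in>UNIV. (1 - K * p$i / (L * (a$i)\<^sup>2)) / (1 - (a$i)\<^sup>2 / p$i))"
    proof (rule prod.cong[OF refl])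
      fix i :: 4
      show "p$i ^ 2 / L * ((L / p$i - K / (a$i)\<^sup>2) / (p$i - (a$i)\<^sup>2))
          = (1 - K * p$i / (L * (a$i)\<^sup>2)) / (1 - (a$i)\<^sup>2 / p$i)"
        using nzp[of i] nza[of i] p_a[of i] nzK by (simp add: divide_simps) algebra
    qed
    finally show ?thesis .
  qed

  have U_diff: "U (Suc k) - U k = Gam (int k - 1) a sp
        * ((K * L powi (int k - 1) - 1) / (K * L powi (int k - 1)))
        * (\<Prod>i\<in>UNIV. qpoch ((a$i)\<^sup>2) (p$i) (int k - 1) / qpoch (K / (a$i)\<^sup>2) (L / p$i) (int k))"
    if "k < n" for k
  proof -
    \<comment> \<open>Mixed indices make \<open>R i\<close> common to both values of
      \<open>U\<close>: raising the numerator index to \<open>k\<close> contributes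
      \<open>1 - b i\<close>, lowering the denominator index to \<open>k - 1\<close> contributes
      \<open>1 - K * L powi (int k - 1) / b i\<close>.\<close>
    define R where "R i = qpoch ((a$i)\<^sup>2) (p$i) (int k - 1) / qpoch (K / (a$i)\<^sup>2) (L / p$i) (int k)" for i
    define b where "b i = (a$i)\<^sup>2 * p$i powi (int k - 1)" for i
    have "U (Suc k) = (\<Prod>i\<in>UNIV. R i * (1 - b i)) \<and>
          U k = (\<Prod>i\<in>UNIV. R i * (1 - K * L powi (int k - 1) / b i))"
    proof (cases k)
      case 0
      \<comment> \<open>Here \<open>b i = (a$i)\<^sup>2 / p$i\<close>, and the numerator of
        \<open>R i\<close> at index -1 is the reciprocal of \<open>1 - b i\<close>; hence
        \<open>U 1 = 1\<close>.\<close>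
      have "R i * (1 - b i) = 1" for i
        using p_a[of i] nzp[of i] by (simp add: R_def b_def 0 qpoch_minus_one field_simps)
      moreover have "R i * (1 - K * L powi (int k - 1) / b i)
          = (1 - K * p$i / (L * (a$i)\<^sup>2)) / (1 - (a$i)\<^sup>2 / p$i)" for i
        by (simp add: R_def b_def 0 qpoch_minus_one field_simps)
      ultimately show ?thesis
        using U0 by (simp add: 0) (simp add: U_def)
    next
      case (Suc m)
      \<comment> \<open>The last factor of this nonzero product must be nonzero, so that it can be
        cancelled to recover \<open>U k\<close>.\<close>
      have "qpoch (K / (a$i)\<^sup>2) (L / p$i) (int (Suc m)) \<noteq> 0" for i
        using denom_K that Suc by blast
      then have "1 - K / (a$i)\<^sup>2 * (L / p$i) ^ m \<noteq> 0" for i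
        unfolding qpoch_Suc by (metis mult_zero_right)
      moreover have "R i * (1 - K * L powi (int k - 1) / b i) =
          qpoch ((a$i)\<^sup>2) (p$i) (int m) / (qpoch (K / (a$i)\<^sup>2) (L / p$i) (int m) * (1 - K / (a$i)\<^sup>2 * (L / p$i) ^ m))
          * (1 - K / (a$i)\<^sup>2 * (L / p$i) ^ m)" for i
        unfolding R_def Suc qpoch_Suc by (simp add: b_def Suc power_divide)
      moreover have "R i * (1 - b i) =
          qpoch ((a$i)\<^sup>2) (p$i) (int k) / qpoch (K / (a$i)\<^sup>2) (L / p$i) (int k)" for i
        unfolding R_def b_def Suc qpoch_Suc by simp
      ultimately show ?thesis
        by (simp add: U_def Suc)
    qed
    then have "U (Suc k) - U k = (\<Prod>i\<in>UNIV. R i) *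
        ((\<Prod>i\<in>UNIV. 1 - b i) - (\<Prod>i\<in>UNIV. 1 - K * L powi (int k - 1) / b i))"
      by (simp only: prod.distrib) (simp only: right_diff_distrib)
    then show ?thesis
      using Gam_identity[OF nza nzsp K L, of "int k - 1"]
      by (simp add: b_def R_def sqrt_p mult_ac)
  qed

  have V_diff: "V (Suc k) - V k = - ((-1) ^ k / qpoch K0 L0 (int k + 1) * g (Suc k) * Q k
      * (\<Prod>i\<in>UNIV. 1 - K0 * L0 ^ k / ((x$i)\<^sup>2 * (q$i) ^ k)))" if "k < n" for k
  proof -
    define B where "B = K0 * L0 ^ k"
    define G where "G = Gam (int k) x sq"
    define c where "c = qpoch K0 L0 (int k)"
    have G: "G \<noteq> 0"
      using denom_Gam that by (simp add: G_def)
    have B: "B \<noteq> 0"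
      using nzK by (simp add: B_def)
    have c': "qpoch K0 L0 (int k + 1) = c * (1 - B)"
      using qpoch_Suc[of K0 L0 k] by (simp add: c_def B_def add.commute)
    \<comment> \<open>The index \<open>Suc k\<close> may equal \<open>n\<close>, which the bound in
      \<open>denom_K0\<close> includes.\<close>
    have "qpoch K0 L0 (int (Suc k)) \<noteq> 0"
      using denom_K0 that Suc_leI by blast
    then have "c \<noteq> 0" "B \<noteq> 1"
      using c' by (auto simp: add.commute)
    have Q': "Q (Suc k) = Q k * (\<Prod>i\<in>UNIV. 1 - (x$i)\<^sup>2 * (q$i) ^ k)"
      unfolding Q_def qpoch_Suc by (rule prod.distrib)
    have g': "g (Suc k) = g k * (B / G)"
      by (simp add: g_def B_def G_def)
    have id: "(\<Prod>i\<in>UNIV. 1 - (x$i)\<^sup>2 * (q$i) ^ k) =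
        (\<Prod>i\<in>UNIV. 1 - B / ((x$i)\<^sup>2 * (q$i) ^ k)) + (B - 1) / B * G"
      using Gam_identity[OF nzx nzsq K0 L0, of "int k"]
      by (simp add: sqrt_q B_def G_def algebra_simps)
    have S: "int (Suc k) = int k + 1"
      by simp
    define P where "P = (\<Prod>i\<in>UNIV. 1 - B / ((x$i)\<^sup>2 * (q$i) ^ k))"
    \<comment> \<open>\<open>V (Suc k)\<close> is \<open>- t\<close> times the new factor of
      \<open>Q (Suc k)\<close>. By \<open>id\<close> that factor is \<open>P\<close> plus a multiple
      of \<open>G\<close>; the multiple of \<open>G\<close> reproduces \<open>V k\<close> exactly,
      so only \<open>- t * P\<close> survives in the difference.\<close>
    define t where "t = (-1) ^ k / (c * (1 - B)) * (g k * (B / G)) * Q k"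
    have "V (Suc k) = - t * (P + (B - 1) / B * G)"
      unfolding V_def S c' Q' g' id P_def[symmetric] t_def by simp
    moreover have "V k = - t * ((B - 1) / B * G)"
      unfolding V_def c_def[symmetric] t_def using G B \<open>c \<noteq> 0\<close> \<open>B \<noteq> 1\<close> by (simp add: field_simps)
    ultimately have "V (Suc k) - V k = - (t * P)"
      by (simp add: algebra_simps)
    then show ?thesis
      unfolding S c' g' t_def P_def B_def[symmetric] by (simp add: mult_ac)
  qed

  \<comment> \<open>For \<open>n = 0\<close> the index is -1, and the second form of
    \<open>U 0\<close> supplies the value.\<close>
  have last: "U n = (\<Prod>i\<in>UNIV. qpoch ((a$i)\<^sup>2) (p$i) (int n - 1) / qpoch (K / (a$i)\<^sup>2) (L / p$i) (int n - 1))"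
    using U0 by (cases n) (simp_all add: qpoch_minus_one U_def mult.commute)

  have "(\<Sum>k<n. (-1) ^ k
        * (Gam (int k - 1) a sp / qpoch K0 L0 (int k))
        * ((K * L powi (int k - 1) - 1) / (K * L powi (int k - 1)))
        * (\<Prod>i\<in>UNIV. qpoch ((a$i)\<^sup>2) (p$i) (int k - 1) * qpoch ((x$i)\<^sup>2) (q$i) (int k)
                    / qpoch (K / (a$i)\<^sup>2) (L / p$i) (int k))
        * (\<Prod>j<k. K0 * L0 ^ j / Gam (int j) x sq)) = (\<Sum>k<n. (U (Suc k) - U k) * V k)"
    by (intro sum.cong refl) (simp add: U_diff V_def Q_def g_def prod.distrib prod_dividef mult_ac)
  moreover have "(\<Sum>k<n. (-1) ^ k / qpoch K0 L0 (int k + 1)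
            * (\<Prod>j\<le>k. K0 * L0 ^ j / Gam (int j) x sq)
            * (\<Prod>i\<in>UNIV. qpoch ((a$i)\<^sup>2) (p$i) (int k) * qpoch ((x$i)\<^sup>2) (q$i) (int k)
                          * (1 - K0 * L0 ^ k / ((x$i)\<^sup>2 * (q$i) ^ k))
                        / qpoch (K / (a$i)\<^sup>2) (L / p$i) (int k)))
      = - (\<Sum>k<n. U (Suc k) * (V (Suc k) - V k))"
    \<comment> \<open>The minus sign in \<open>V_diff\<close> cancels the one from summation by
      parts, so this sum enters the result with a plus sign.\<close>
    unfolding sum_negf[symmetric]
    by (intro sum.cong refl)
       (simp add: V_diff U_def Q_def g_def prod.distrib prod_dividef lessThan_Suc_atMost mult_ac)
  moreover have "(-1) ^ n / qpoch K0 L0 (int n)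
        * (\<Prod>i\<in>UNIV. qpoch ((a$i)\<^sup>2) (p$i) (int n - 1) * qpoch ((x$i)\<^sup>2) (q$i) (int n)
                    / qpoch (K / (a$i)\<^sup>2) (L / p$i) (int n - 1))
        * (\<Prod>j<n. K0 * L0 ^ j / Gam (int j) x sq) = U n * V n"
    by (simp add: last V_def Q_def g_def prod.distrib prod_dividef mult_ac)
  \<comment> \<open>All products in \<open>V 0\<close> are empty, so \<open>V 0 = 1\<close>.\<close>
  moreover have "(\<Prod>i\<in>UNIV. (L / p$i - K / (a$i)\<^sup>2) / (p$i - (a$i)\<^sup>2)) = U 0 * V 0"
    by (simp add: U_def V_def Q_def g_def)
  ultimately show ?thesis
    using summation_by_parts[of U V n] by simp
qed

end
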